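(* Let $\mathcal{T}_M$ be a valid PDDSparse tessellation (with $M$ subdomains) of $\Omega$, and let $G^*$ be the principal submatrix of the PDDSparse matrix $G$ obtained by deleting the rows and columns of the knots lying on $\partial\Omega_A$. Then $G^*$ is irreducible (equivalently, its digraph, with an edge $i\to j$ iff $G^*_{ij}\neq0$, is strongly connected).
   Context: $\Omega\subset\mathbb{R}^2$ is bounded, open, connected, with $\partial\Omega=\partial\Omega_A\cup\partial\Omega_R$ (disjoint union, $\partial\Omega_A\neq\emptyset$). Tessellation. $\Omega$ is embedded in a grid of equal squares. The squares intersecting $\Omega$ form the tessellation; each such square intersected with $\Omega$ is a subdomain. A subdomain is floating if its square is contained in $\Omega$ (save perhaps isolated points on $\partial\Omega$), otherwise it is a perimeter subdomain. Two subdomains lie side by side if their squares share a side that meets $\Omega$; the portion of that side in $\Omega$ (taken to be a segment) is their interface. A tessellation $\mathcal{T}_M$ with $M$ subdomains is called valid if (i) $M\ge9$; (ii) it contains a $3\times3$ block of floating subdomains; (iii) every subdomain lies side by side with at least another one. Knots. Finitely many knots $\mathbf{x}_1,\dots,\mathbf{x}_N$ are placed on the (closed) interfaces. There is a knot at each grid crossing in $\Omega$ and at each intersection of an interface with $\partial\Omega$ (these are the end knots of interfaces); the other knots are mid knots, and every interface has at least one mid knot. Patches and stencils. The patch $\Pi(\mathbf{x}_i)$ is the union of all subdomains to whose closure $\mathbf{x}_i$ belongs. Its boundary consists of interfaces (grouped into up to four sides $O\in\{E,N,W,S\}$) and possibly portions of $\partial\Omega$. The stencil of $\mathbf{x}_i\notin\partial\Omega_A$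 consists of all knots on the interfaces making up $\partial\Pi(\mathbf{x}_i)$, possibly together with further knots collinear with a side, beyond its ends ("elongated" stencil). Sparsity pattern of the PDDSparse matrix $G\in\mathbb{R}^{N\times N}$. $G_{ii}=1$ for all $i$. If $\mathbf{x}_i\in\partial\Omega_A$, all other entries of row $i$ are zero. If $\mathbf{x}_i\notin\partial\Omega_A$ and $j\ne i$, then $G_{ij}\neq0$ if and only if $\mathbf{x}_j$ belongs to the stencil of $\mathbf{x}_i$. *)

theory Defs
  imports
    "Graph_Theory.Digraph_Component"
    "Jordan_Normal_Form.DL_Submatrix"
    "HOL-Analysis.Analysis"
begin

text \<open>Throughout, \<open>connected\<close> is the topological notion.\<close>

hide_const (open) Digraph_Component.connected

section \<open>Irreducible matrices\<close>

text \<open>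
  Reducible: \<open>P A P\<^sup>T\<close> is block upper triangular for some permutation matrix \<open>P\<close>, with both
  diagonal blocks nonempty; \<open>p\<close> is the permutation and \<open>r\<close> the size of the first block.
\<close>

definition reducible_mat :: "'a::zero mat \<Rightarrow> bool" where
  "reducible_mat A \<longleftrightarrow>
     (\<exists>p r. p permutes {0..<dim_row A} \<and> 0 < r \<and> r < dim_row A \<and>
            (\<forall>i\<in>{r..<dim_row A}. \<forall>j\<in>{0..<r}. A $$ (p i, p j) = 0))"

definition irreducible_mat :: "'a::zero mat \<Rightarrow> bool" where
  "irreducible_mat A \<longleftrightarrow> square_mat A \<and> \<not> reducible_mat A"

definition mat_digraph :: "'a::zero mat \<Rightarrow> (nat, nat \<times> nat) pre_digraph" where
  "mat_digraph A =
     \<lparr> verts = {0..<dim_row A},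
       arcs = {(i, j). i < dim_row A \<and> j < dim_col A \<and> A $$ (i, j) \<noteq> 0},
       tail = fst,
       head = snd \<rparr>"


section \<open>The grid and its subdomains\<close>

text \<open>
  The grid has a node at \<open>c\<close> and mesh size \<open>h\<close>; its squares, and the subdomains they cut out
  of \<open>\<Omega>\<close>, are addressed by pairs of integers. Squares are closed, so a subdomain is
  relatively closed in \<open>\<Omega>\<close> and the common side of two adjacent subdomains of a patch is
  not part of the boundary of the patch.
\<close>

definition grid_node :: "real \<times> real \<Rightarrow> real \<Rightarrow> int \<times> int \<Rightarrow> real \<times> real" where
  "grid_node c h q = (fst c + of_int (fst q) * h, snd c + of_int (snd q) * h)"

definition grid_square :: "real \<times> real \<Rightarrow> real \<Rightarrow> int \<times> int \<Rightarrow> (real \<times> real) set" where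
  "grid_square c h q = cbox (grid_node c h q) (grid_node c h (q + (1, 1)))"

definition tessellation :: "(real \<times> real) set \<Rightarrow> real \<times> real \<Rightarrow> real \<Rightarrow> (int \<times> int) set" where
  "tessellation \<Omega> c h = {q. grid_square c h q \<inter> \<Omega> \<noteq> {}}"

definition subdomain :: "(real \<times> real) set \<Rightarrow> real \<times> real \<Rightarrow> real \<Rightarrow> int \<times> int \<Rightarrow> (real \<times> real) set" where
  "subdomain \<Omega> c h q = grid_square c h q \<inter> \<Omega>"

definition floating :: "(real \<times> real) set \<Rightarrow> real \<times> real \<Rightarrow> real \<Rightarrow> int \<times> int \<Rightarrow> bool" where
  "floating \<Omega> c h q \<longleftrightarrow>
     q \<in> tessellation \<Omega> c h \<and>
     (\<forall>p \<in> grid_square c h q - \<Omega>.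
        p \<in> frontier \<Omega> \<and> p isolated_in (grid_square c h q - \<Omega>))"

datatype compass = East | North | West | South

fun step :: "compass \<Rightarrow> int \<times> int" where
  "step East = (1, 0)"
| "step North = (0, 1)"
| "step West = (-1, 0)"
| "step South = (0, -1)"

definition interface ::
  "(real \<times> real) set \<Rightarrow> real \<times> real \<Rightarrow> real \<Rightarrow> int \<times> int \<Rightarrow> int \<times> int \<Rightarrow> (real \<times> real) set" where
  "interface \<Omega> c h q q' = grid_square c h q \<inter> grid_square c h q' \<inter> \<Omega>"

definition side_by_side ::
  "(real \<times> real) set \<Rightarrow> real \<times> real \<Rightarrow> real \<Rightarrow> int \<times> int \<Rightarrow> int \<times> int \<Rightarrow> bool" where
  "side_by_side \<Omega> c h q q' \<longleftrightarrow> (\<exists>d. q' = q + step d) \<and> interface \<Omega> c h q q' \<noteq> {}"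

definition interfaces :: "(real \<times> real) set \<Rightarrow> real \<times> real \<Rightarrow> real \<Rightarrow> (real \<times> real) set set" where
  "interfaces \<Omega> c h = {interface \<Omega> c h q q' | q q'. side_by_side \<Omega> c h q q'}"

text \<open>
  Interfaces lie in a side of a square, so convexity says that they are segments, which may
  lack their endpoints when these are on \<open>frontier \<Omega>\<close>.
\<close>

definition valid_tessellation ::
  "(real \<times> real) set \<Rightarrow> real \<times> real \<Rightarrow> real \<Rightarrow> nat \<Rightarrow> bool" where
  "valid_tessellation \<Omega> c h M \<longleftrightarrow>
     h > 0 \<and>
     (\<forall>J \<in> interfaces \<Omega> c h. convex J) \<and>
     card (tessellation \<Omega> c h) = M \<and>
     M \<ge> 9 \<and>
     (\<exists>k l. \<forall>i \<in> {k..k + 2}. \<forall>j \<in> {l..l + 2}. floating \<Omega> c h (i, j)) \<and>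
     (\<forall>q \<in> tessellation \<Omega> c h. \<exists>q' \<in> tessellation \<Omega> c h. side_by_side \<Omega> c h q q')"


section \<open>Knots\<close>

definition end_points :: "(real \<times> real) set \<Rightarrow> real \<times> real \<Rightarrow> real \<Rightarrow> (real \<times> real) set" where
  "end_points \<Omega> c h =
     (range (grid_node c h) \<inter> \<Omega>) \<union> (\<Union>J \<in> interfaces \<Omega> c h. closure J \<inter> frontier \<Omega>)"

text \<open>Knots are numbered from \<open>0\<close> to \<open>N - 1\<close>, matching the indices of \<open>N \<times> N\<close> matrices.\<close>

definition knot_family ::
  "(real \<times> real) set \<Rightarrow> real \<times> real \<Rightarrow> real \<Rightarrow> nat \<Rightarrow> (nat \<Rightarrow> real \<times> real) \<Rightarrow> bool" where
  "knot_family \<Omega> c h N x \<longleftrightarrow>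
     inj_on x {0..<N} \<and>
     x ` {0..<N} \<subseteq> (\<Union>J \<in> interfaces \<Omega> c h. closure J) \<and>
     end_points \<Omega> c h \<subseteq> x ` {0..<N} \<and>
     (\<forall>J \<in> interfaces \<Omega> c h. \<exists>i<N. x i \<in> closure J \<and> x i \<notin> end_points \<Omega> c h)"


section \<open>Patches and stencils\<close>

definition patch_squares ::
  "(real \<times> real) set \<Rightarrow> real \<times> real \<Rightarrow> real \<Rightarrow> real \<times> real \<Rightarrow> (int \<times> int) set" where
  "patch_squares \<Omega> c h p = {q \<in> tessellation \<Omega> c h. p \<in> closure (subdomain \<Omega> c h q)}"

definition patch :: "(real \<times> real) set \<Rightarrow> real \<times> real \<Rightarrow> real \<Rightarrow> real \<times> real \<Rightarrow> (real \<times> real) set" where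
  "patch \<Omega> c h p = (\<Union>q \<in> patch_squares \<Omega> c h p. subdomain \<Omega> c h q)"

definition patch_interfaces ::
  "(real \<times> real) set \<Rightarrow> real \<times> real \<Rightarrow> real \<Rightarrow> real \<times> real \<Rightarrow> (real \<times> real) set set" where
  "patch_interfaces \<Omega> c h p = {J \<in> interfaces \<Omega> c h. J \<subseteq> frontier (patch \<Omega> c h p)}"

definition patch_side ::
  "(real \<times> real) set \<Rightarrow> real \<times> real \<Rightarrow> real \<Rightarrow> real \<times> real \<Rightarrow> compass \<Rightarrow> (real \<times> real) set set" where
  "patch_side \<Omega> c h p d =
     {J \<in> patch_interfaces \<Omega> c h p.
        \<exists>q \<in> patch_squares \<Omega> c h p.
          side_by_side \<Omega> c h q (q + step d) \<and> J = interface \<Omega> c h q (q + step d)}"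

definition base_stencil ::
  "(real \<times> real) set \<Rightarrow> real \<times> real \<Rightarrow> real \<Rightarrow> nat \<Rightarrow> (nat \<Rightarrow> real \<times> real) \<Rightarrow> nat \<Rightarrow> nat set" where
  "base_stencil \<Omega> c h N x i =
     {j. j < N \<and> (\<exists>J \<in> patch_interfaces \<Omega> c h (x i). x j \<in> closure J)}"

text \<open>
  The knots available for elongation: on the straight line carrying a side of the patch, but
  outside the smallest segment containing that side.
\<close>

definition elongation_knots ::
  "(real \<times> real) set \<Rightarrow> real \<times> real \<Rightarrow> real \<Rightarrow> nat \<Rightarrow> (nat \<Rightarrow> real \<times> real) \<Rightarrow> nat \<Rightarrow> nat set" where
  "elongation_knots \<Omega> c h N x i =
     {j. j < N \<and>
         (\<exists>d. (\<exists>J \<in> patch_side \<Omega> c h (x i) d. x j \<in> affine hull J) \<and>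
              x j \<notin> convex hull (\<Union>J \<in> patch_side \<Omega> c h (x i) d. closure J))}"

definition admissible_stencil ::
  "(real \<times> real) set \<Rightarrow> real \<times> real \<Rightarrow> real \<Rightarrow> nat \<Rightarrow> (nat \<Rightarrow> real \<times> real) \<Rightarrow> nat \<Rightarrow> nat set \<Rightarrow> bool" where
  "admissible_stencil \<Omega> c h N x i S \<longleftrightarrow>
     base_stencil \<Omega> c h N x i \<subseteq> S \<and>
     S \<subseteq> base_stencil \<Omega> c h N x i \<union> elongation_knots \<Omega> c h N x i"


section \<open>The PDDSparse matrix\<close>

definition pddsparse_pattern ::
  "nat \<Rightarrow> (nat \<Rightarrow> real \<times> real) \<Rightarrow> (real \<times> real) set \<Rightarrow> (nat \<Rightarrow> nat set) \<Rightarrow> real mat \<Rightarrow> bool" where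
  "pddsparse_pattern N x \<Gamma>\<^sub>A S G \<longleftrightarrow>
     G \<in> carrier_mat N N \<and>
     (\<forall>i<N. G $$ (i, i) = 1) \<and>
     (\<forall>i<N. x i \<in> \<Gamma>\<^sub>A \<longrightarrow> (\<forall>j<N. j \<noteq> i \<longrightarrow> G $$ (i, j) = 0)) \<and>
     (\<forall>i<N. x i \<notin> \<Gamma>\<^sub>A \<longrightarrow> (\<forall>j<N. j \<noteq> i \<longrightarrow> (G $$ (i, j) \<noteq> 0 \<longleftrightarrow> j \<in> S i)))"

definition non_absorbing :: "nat \<Rightarrow> (nat \<Rightarrow> real \<times> real) \<Rightarrow> (real \<times> real) set \<Rightarrow> nat set" where
  "non_absorbing N x \<Gamma>\<^sub>A = {i. i < N \<and> x i \<notin> \<Gamma>\<^sub>A}"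

end

theory Submission
  imports Defs
begin

text \<open>
  Call two subdomains neighbours if they lie side by side. The neighbour graph is connected:
  if the squares split into two classes, their unions are closed, cover \<open>\<Omega>\<close> and hence meet in
  \<open>\<Omega>\<close>; squares that meet in \<open>\<Omega>\<close> only at a corner are joined through a third square at that corner.

  The geometric link with the matrix is that the boundary of a patch contains every interface
  between a square of the patch and a square outside it, so a knot has arcs to all knots
  of such an interface. This is used twice. A knot touches at most four of the at least nine
  squares, so by connectivity some interface leads out of its patch; hence every knot reaches all
  knots of at least one interface. A mid knot of the interface between \<open>q\<close> and \<open>r\<close> has the patch
  \<open>{q, r}\<close>, so once it is reached, so are all knots on the other interfaces of \<open>q\<close> and of \<open>r\<close>.
  Mid knots are in \<open>\<Omega>\<close>, hence never absorbing, and each interface has one, so reachability spreads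
  from interface to interface along the connected neighbour graph until every knot is reached.
  Elongating stencils only adds arcs.
\<close>

section \<open>Irreducibility and strong connectivity\<close>

lemma reachable_in_closed_set:
  assumes "u \<rightarrow>\<^sup>*\<^bsub>D\<^esub> v" and "u \<in> C"
    and "\<And>a b. a \<in> C \<Longrightarrow> (a, b) \<in> arcs_ends D \<Longrightarrow> b \<in> C"
  shows "v \<in> C"
  using assms(1) unfolding reachable_def
  by (induction rule: rtrancl_on_induct) (use assms(2,3) in auto)

lemma arcs_ends_mat_digraph:
  "(i, j) \<in> arcs_ends (mat_digraph A) \<longleftrightarrow> i < dim_row A \<and> j < dim_col A \<and> A $$ (i, j) \<noteq> 0"
  by (force simp: arcs_ends_conv mat_digraph_def)

text \<open>
  In a block triangular form, the indices of the lower block cannot leave it along arcs.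
\<close>

lemma irreducible_mat_if_strongly_connected:
  assumes "square_mat A" and "strongly_connected (mat_digraph A)"
  shows "irreducible_mat A"
  unfolding irreducible_mat_def
proof
  show "\<not> reducible_mat A"
  proof
    assume "reducible_mat A"
    then obtain p r where p: "p permutes {0..<dim_row A}" and r: "0 < r" "r < dim_row A"
      and zero: "\<And>i j. i \<in> {r..<dim_row A} \<Longrightarrow> j \<in> {0..<r} \<Longrightarrow> A $$ (p i, p j) = 0"
      unfolding reducible_mat_def by blast
    have "p r < dim_row A" "p 0 < dim_row A"
      using permutes_in_image[OF p] r by auto
    then have "p r \<rightarrow>\<^sup>*\<^bsub>mat_digraph A\<^esub> p 0"
      using assms(2) unfolding strongly_connected_def by (auto simp: mat_digraph_def)
    then have "p 0 \<in> p ` {r..<dim_row A}"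
    proof (rule reachable_in_closed_set)
      show "p r \<in> p ` {r..<dim_row A}"
        using r by auto
    next
      fix a b
      assume "a \<in> p ` {r..<dim_row A}" and ab: "(a, b) \<in> arcs_ends (mat_digraph A)"
      then obtain i where i: "i \<in> {r..<dim_row A}" "a = p i"
        by auto
      have b: "b < dim_row A" "A $$ (a, b) \<noteq> 0"
        using ab \<open>square_mat A\<close> by (auto simp: arcs_ends_mat_digraph)
      then have "b \<in> p ` {0..<dim_row A}"
        using permutes_image[OF p] by auto
      then obtain j where j: "j < dim_row A" "b = p j"
        by auto
      then have "\<not> j < r"
        using zero[of i j] i b by auto
      then show "b \<in> p ` {r..<dim_row A}"
        using j by auto
    qed
    then show False
      using r(1) by (simp add: inj_image_mem_iff[OF permutes_inj[OF p]])
  qed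
qed (fact assms(1))

text \<open>
  Strong connectivity as a cut condition, phrased in the indices of the ambient matrix, so that
  the renumbering made by \<^const>\<open>submatrix\<close> need not be followed any further.
\<close>

lemma strongly_connected_submatrixI:
  assumes A: "A \<in> carrier_mat n n" and I: "I \<subseteq> {0..<n}" "I \<noteq> {}"
    and cut: "\<And>R. R \<subseteq> I \<Longrightarrow> R \<noteq> {} \<Longrightarrow>
                (\<And>i j. i \<in> R \<Longrightarrow> j \<in> I \<Longrightarrow> A $$ (i, j) \<noteq> 0 \<Longrightarrow> j \<in> R) \<Longrightarrow> R = I"
  shows "strongly_connected (mat_digraph (submatrix A I I))"
proof -
  let ?B = "submatrix A I I"
  have fin: "finite I"
    using I(1) finite_subset by blast
  have set_eq: "{i. i < n \<and> i \<in> I} = I"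
    using I(1) by auto
  have dim: "dim_row ?B = card I" "dim_col ?B = card I"
    using A set_eq by (auto simp: dim_submatrix)
  have entry: "?B $$ (a, b) = A $$ (pick I a, pick I b)" if "a < card I" "b < card I" for a b
    using that A set_eq by (subst submatrix_index) auto
  have verts: "verts (mat_digraph ?B) = {0..<card I}"
    by (simp add: mat_digraph_def dim)
  show ?thesis
  proof
    show "verts (mat_digraph ?B) \<noteq> {}"
      using fin I(2) by (simp add: verts card_gt_0_iff)
  next
    fix u v
    assume "u \<in> verts (mat_digraph ?B)" "v \<in> verts (mat_digraph ?B)"
    then have u: "u < card I" and v: "v < card I"
      by (auto simp: verts)
    define W where "W = {w. u \<rightarrow>\<^sup>*\<^bsub>mat_digraph ?B\<^esub> w}"
    have W_verts: "w < card I" if "w \<in> W" for w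
      using that by (auto simp: W_def reachable_def verts dest: in_rtrancl_on_in_F(2))
    have "u \<in> W"
      using u by (simp add: W_def reachable_def verts)
    have "pick I ` W = I"
    proof (rule cut)
      show "pick I ` W \<subseteq> I"
        using W_verts pick_in_set_le by blast
      show "pick I ` W \<noteq> {}"
        using \<open>u \<in> W\<close> by auto
    next
      fix i j
      assume "i \<in> pick I ` W" and j: "j \<in> I" and ij: "A $$ (i, j) \<noteq> 0"
      then obtain w where w: "w \<in> W" "i = pick I w"
        by auto
      define k where "k = card {a \<in> I. a < j}"
      have k: "pick I k = j"
        unfolding k_def using pick_card_in_set[OF j] by simp
      have "{a \<in> I. a < j} \<subset> I"
        using j by auto
      then have "k < card I"
        unfolding k_def using fin psubset_card_mono by blast
      then have "(w, k) \<in> arcs_ends (mat_digraph ?B)"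
        using W_verts[OF w(1)] w(2) k ij by (simp add: arcs_ends_mat_digraph dim entry)
      with w(1) \<open>k < card I\<close> have "k \<in> W"
        using rtrancl_on_into_rtrancl_on[of u w "verts (mat_digraph ?B)" _ k]
        by (simp add: W_def reachable_def verts)
      then show "j \<in> pick I ` W"
        using k by blast
    qed
    then have "pick I v \<in> pick I ` W"
      using pick_in_set_le[OF v] by blast
    then obtain w where w: "w \<in> W" "pick I v = pick I w"
      by (rule imageE) blast
    then have "w = v"
      using card_pick_le[OF W_verts[OF w(1)]] card_pick_le[OF v] by simp
    then show "u \<rightarrow>\<^sup>*\<^bsub>mat_digraph ?B\<^esub> v"
      using w(1) by (simp add: W_def)
  qed
qed


section \<open>Squares of the grid\<close>

lemma mem_grid_square:
  "p \<in> grid_square c h q \<longleftrightarrow>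
     fst c + of_int (fst q) * h \<le> fst p \<and> fst p \<le> fst c + (of_int (fst q) + 1) * h \<and>
     snd c + of_int (snd q) * h \<le> snd p \<and> snd p \<le> snd c + (of_int (snd q) + 1) * h"
  by (cases p) (auto simp: grid_square_def grid_node_def cbox_Pair_eq)

lemma mem_interior_grid_square:
  "p \<in> interior (grid_square c h q) \<longleftrightarrow>
     fst c + of_int (fst q) * h < fst p \<and> fst p < fst c + (of_int (fst q) + 1) * h \<and>
     snd c + of_int (snd q) * h < snd p \<and> snd p < snd c + (of_int (snd q) + 1) * h"
  by (cases p) (auto simp: grid_square_def grid_node_def cbox_Pair_eq interior_Times)

lemma closed_grid_square: "closed (grid_square c h q)"
  unfolding grid_square_def by (rule closed_cbox)

lemma grid_square_subset_closure_interior: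
  assumes "h > 0"
  shows "grid_square c h q \<subseteq> closure (interior (grid_square c h q))"
proof -
  have "grid_node c h q + (h / 2, h / 2) \<in> interior (grid_square c h q)"
    using assms by (simp add: mem_interior_grid_square grid_node_def algebra_simps)
  then have "closure (interior (grid_square c h q)) = closure (grid_square c h q)"
    by (intro convex_closure_interior) (auto simp: grid_square_def)
  then show ?thesis
    using closure_subset by blast
qed

lemma cell_index_le:
  fixes m n :: int and h t s :: real
  assumes "h > 0" and "s + of_int m * h \<le> t" and "t \<le> s + (of_int n + 1) * h"
  shows "m \<le> n + 1"
proof -
  have "of_int m * h \<le> (of_int n + 1) * h"
    using assms by linarith
  then show ?thesis
    using assms(1) by (simp flip: of_int_le_iff)
qed

lemma cell_index_less:
  fixes m n :: int and h t s :: real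
  assumes "h > 0" and "s + of_int m * h \<le> t" and "t < s + (of_int n + 1) * h"
  shows "m \<le> n"
proof -
  have "of_int m * h < (of_int n + 1) * h"
    using assms by linarith
  then have "real_of_int m < real_of_int (n + 1)"
    using assms(1) by simp
  then show ?thesis
    by linarith
qed

lemma cell_index_greater:
  fixes m n :: int and h t s :: real
  assumes "h > 0" and "s + of_int m * h < t" and "t \<le> s + (of_int n + 1) * h"
  shows "m \<le> n"
proof -
  have "of_int m * h < (of_int n + 1) * h"
    using assms by linarith
  then have "real_of_int m < real_of_int (n + 1)"
    using assms(1) by simp
  then show ?thesis
    by linarith
qed

lemma interior_grid_square_unique:
  assumes "h > 0" and "p \<in> interior (grid_square c h r)" and "p \<in> grid_square c h q"
  shows "q = r"
proof (rule prod_eqI)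
  note ineqs = assms(2,3)[unfolded mem_interior_grid_square mem_grid_square]
  show "fst q = fst r"
    using ineqs cell_index_less[OF assms(1), of "fst c" "fst q" "fst p" "fst r"]
      cell_index_greater[OF assms(1), of "fst c" "fst r" "fst p" "fst q"] by auto
  show "snd q = snd r"
    using ineqs cell_index_less[OF assms(1), of "snd c" "snd q" "snd p" "snd r"]
      cell_index_greater[OF assms(1), of "snd c" "snd r" "snd p" "snd q"] by auto
qed

text \<open>
  Along each axis a coordinate lies in one cell, or in two if it is a multiple of the mesh size.
\<close>

lemma squares_containing_point:
  assumes "h > 0"
  shows "{q. p \<in> grid_square c h q} =
           {\<lceil>(fst p - fst c) / h\<rceil> - 1..\<lfloor>(fst p - fst c) / h\<rfloor>} \<times>
           {\<lceil>(snd p - snd c) / h\<rceil> - 1..\<lfloor>(snd p - snd c) / h\<rfloor>}"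
proof -
  have cell: "s + of_int m * h \<le> t \<and> t \<le> s + (of_int m + 1) * h \<longleftrightarrow>
          \<lceil>(t - s) / h\<rceil> - 1 \<le> m \<and> m \<le> \<lfloor>(t - s) / h\<rfloor>" for s t :: real and m :: int
  proof -
    have "s + of_int m * h \<le> t \<longleftrightarrow> of_int m \<le> (t - s) / h"
      using assms by (simp add: pos_le_divide_eq algebra_simps)
    moreover have "t \<le> s + (of_int m + 1) * h \<longleftrightarrow> (t - s) / h \<le> of_int (m + 1)"
      using assms by (simp add: pos_divide_le_eq algebra_simps)
    ultimately show ?thesis
      unfolding le_floor_iff[symmetric] ceiling_le_iff[symmetric] by linarith
  qed
  show ?thesis
    by (auto simp: mem_grid_square cell[symmetric])
qed

lemma card_cells_le:
  fixes a :: real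
  shows "card {\<lceil>a\<rceil> - 1..\<lfloor>a\<rfloor>} \<le> 2" and "a \<notin> \<int> \<Longrightarrow> card {\<lceil>a\<rceil> - 1..\<lfloor>a\<rfloor>} \<le> 1"
proof -
  have "\<lfloor>a\<rfloor> \<le> \<lceil>a\<rceil>"
    by (rule floor_le_ceiling)
  then show "card {\<lceil>a\<rceil> - 1..\<lfloor>a\<rfloor>} \<le> 2"
    by (simp add: nat_le_iff)
  assume "a \<notin> \<int>"
  then have "\<lceil>a\<rceil> = \<lfloor>a\<rfloor> + 1"
    by (metis ceiling_altdef Ints_of_int)
  then show "card {\<lceil>a\<rceil> - 1..\<lfloor>a\<rfloor>} \<le> 1"
    by simp
qed

lemma finite_squares_containing_point:
  assumes "h > 0"
  shows "finite {q. p \<in> grid_square c h q}"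
  unfolding squares_containing_point[OF assms] by simp

lemma card_squares_containing_point:
  assumes "h > 0"
  shows "card {q. p \<in> grid_square c h q} \<le> 4"
  unfolding squares_containing_point[OF assms] card_cartesian_product
  using mult_le_mono[OF card_cells_le(1) card_cells_le(1)] by (metis numeral_Bit0 mult_2)

lemma card_squares_containing_non_node:
  assumes "h > 0" and "p \<notin> range (grid_node c h)"
  shows "card {q. p \<in> grid_square c h q} \<le> 2"
proof -
  let ?a = "(fst p - fst c) / h" and ?b = "(snd p - snd c) / h"
  have "?a \<notin> \<int> \<or> ?b \<notin> \<int>"
  proof (rule ccontr)
    assume "\<not> ?thesis"
    then obtain m n where "?a = of_int m" "?b = of_int n"
      by (auto elim!: Ints_cases)
    then have "p = grid_node c h (m, n)"
      using assms(1) by (auto simp: grid_node_def field_simps prod_eq_iff)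
    then show False
      using assms(2) by blast
  qed
  then show ?thesis
    unfolding squares_containing_point[OF assms(1)] card_cartesian_product
    using mult_le_mono[OF card_cells_le(1)[of ?a] card_cells_le(2)[of ?b]]
      mult_le_mono[OF card_cells_le(2)[of ?a] card_cells_le(1)[of ?b]] by auto
qed


section \<open>The neighbour graph of the subdomains\<close>

lemma side_by_side_commute:
  "side_by_side \<Omega> c h q r \<longleftrightarrow> side_by_side \<Omega> c h r q"
proof -
  have "side_by_side \<Omega> c h r q" if "side_by_side \<Omega> c h q r" for q r
  proof -
    from that obtain d where d: "r = q + step d"
      by (auto simp: side_by_side_def)
    have "\<exists>d'. step d' = - step d"
      by (cases d) (auto intro: exI[of _ East] exI[of _ North] exI[of _ West] exI[of _ South])
    then obtain d' where "step d' = - step d" ..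
    then have "q = r + step d'"
      using d by simp
    then show ?thesis
      using that by (auto simp: side_by_side_def interface_def Int_ac)
  qed
  then show ?thesis
    by blast
qed

lemma interface_commute: "interface \<Omega> c h q r = interface \<Omega> c h r q"
  by (auto simp: interface_def)

lemma side_by_side_in_tessellation:
  "side_by_side \<Omega> c h q r \<Longrightarrow> q \<in> tessellation \<Omega> c h"
  by (auto simp: side_by_side_def interface_def tessellation_def)

lemma side_by_side_distinct: "side_by_side \<Omega> c h q r \<Longrightarrow> q \<noteq> r"
proof
  assume "side_by_side \<Omega> c h q r" "q = r"
  then obtain d where "step d = 0"
    by (auto simp: side_by_side_def)
  then show False
    by (cases d) (auto simp: zero_prod_def)
qed

lemma side_by_side_if_aligned:
  assumes "h > 0" and z: "z \<in> grid_square c h q" "z \<in> grid_square c h r" "z \<in> \<Omega>"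
    and "q \<noteq> r" and "fst q = fst r \<or> snd q = snd r"
  shows "side_by_side \<Omega> c h q r"
proof -
  note ineqs = z(1,2)[unfolded mem_grid_square]
  have "fst q \<le> fst r + 1" "fst r \<le> fst q + 1" "snd q \<le> snd r + 1" "snd r \<le> snd q + 1"
    using ineqs cell_index_le[OF assms(1)] by blast+
  then have "r = q + step East \<or> r = q + step North \<or> r = q + step West \<or> r = q + step South"
    using assms(5,6) by (cases q; cases r) auto
  then have "\<exists>d. r = q + step d"
    by blast
  then show ?thesis
    using z by (auto simp: side_by_side_def interface_def)
qed

text \<open>
  Connectedness of the neighbour graph, as a cut condition. The point \<open>z\<close> below may be a common
  corner of two squares; the square sharing its column with one and its row with the
  other contains \<open>z\<close> too.
\<close>

lemma neighbours_across_cut: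
  assumes "h > 0" and conn: "connected \<Omega>" and fin: "finite (tessellation \<Omega> c h)"
    and X: "X \<subseteq> tessellation \<Omega> c h" "X \<noteq> {}" "X \<noteq> tessellation \<Omega> c h"
  obtains q r where "q \<in> X" "r \<in> tessellation \<Omega> c h - X" "side_by_side \<Omega> c h q r"
proof -
  let ?T = "tessellation \<Omega> c h"
  define A B where "A = (\<Union>q\<in>X. grid_square c h q)" and "B = (\<Union>q\<in>?T - X. grid_square c h q)"
  have "closed A" "closed B"
    unfolding A_def B_def using fin finite_subset[OF X(1) fin]
    by (intro closed_UN ballI closed_grid_square; simp)+
  moreover have "\<Omega> \<subseteq> A \<union> B"
  proof
    fix z assume z: "z \<in> \<Omega>"
    let ?a = "(fst z - fst c) / h" and ?b = "(snd z - snd c) / h"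
    have "\<lceil>?a\<rceil> - 1 \<le> \<lfloor>?a\<rfloor>" "\<lceil>?b\<rceil> - 1 \<le> \<lfloor>?b\<rfloor>"
      by linarith+
    then have "(\<lfloor>?a\<rfloor>, \<lfloor>?b\<rfloor>) \<in> {q. z \<in> grid_square c h q}"
      unfolding squares_containing_point[OF assms(1)] by auto
    then show "z \<in> A \<union> B"
      using z unfolding A_def B_def tessellation_def by blast
  qed
  moreover have "A \<inter> \<Omega> \<noteq> {}" "B \<inter> \<Omega> \<noteq> {}"
    using X unfolding A_def B_def tessellation_def by auto
  ultimately obtain z where z: "z \<in> A" "z \<in> B" "z \<in> \<Omega>"
    using conn unfolding connected_closed by blast
  then obtain q r where qr: "q \<in> X" "r \<in> ?T - X" "z \<in> grid_square c h q" "z \<in> grid_square c h r"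
    unfolding A_def B_def by blast
  define m where "m = (fst q, snd r)"
  have zm: "z \<in> grid_square c h m"
    using qr(3,4) by (simp add: mem_grid_square m_def)
  then have mT: "m \<in> ?T"
    using z(3) by (auto simp: tessellation_def)
  show thesis
  proof (cases "m \<in> X")
    case True
    then have "m \<noteq> r"
      using qr(2) by blast
    then have "side_by_side \<Omega> c h m r"
      using side_by_side_if_aligned[OF assms(1) zm qr(4) z(3)] by (simp add: m_def)
    then show thesis
      using that True qr(2) by blast
  next
    case False
    then have "q \<noteq> m"
      using qr(1) by blast
    then have "side_by_side \<Omega> c h q m"
      using side_by_side_if_aligned[OF assms(1) qr(3) zm z(3)] by (simp add: m_def)
    then show thesis
      using that False qr(1) mT by blast
  qed
qed


section \<open>Patches and stencils\<close>

text \<open>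
  Points in the interior of the outside square approach the interface and avoid
  every square of \<open>P\<close>.
\<close>

lemma interface_subset_frontier:
  assumes "h > 0" and "open \<Omega>" and "q \<in> P" and "r \<notin> P"
  shows "interface \<Omega> c h q r \<subseteq> frontier (\<Union>s\<in>P. subdomain \<Omega> c h s)" (is "_ \<subseteq> frontier ?U")
proof
  fix z assume "z \<in> interface \<Omega> c h q r"
  then have z: "z \<in> grid_square c h q" "z \<in> grid_square c h r" "z \<in> \<Omega>"
    by (auto simp: interface_def)
  then have "z \<in> closure ?U"
    using \<open>q \<in> P\<close> closure_subset[of ?U] by (auto simp: subdomain_def)
  moreover have "z \<in> closure (- ?U)"
  proof -
    have "\<Omega> \<inter> interior (grid_square c h r) \<subseteq> - ?U"
      using interior_grid_square_unique[OF assms(1)] \<open>r \<notin> P\<close> unfolding subdomain_def by blast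
    moreover have "z \<in> closure (\<Omega> \<inter> interior (grid_square c h r))"
      using open_Int_closure_subset[OF assms(2)] grid_square_subset_closure_interior[OF assms(1)] z
      by blast
    ultimately show ?thesis
      using closure_mono by blast
  qed
  ultimately show "z \<in> frontier ?U"
    by (simp add: frontier_closures)
qed

lemma base_stencil_across_patch_boundary:
  assumes "h > 0" and "open \<Omega>" and "side_by_side \<Omega> c h q r"
    and "q \<in> patch_squares \<Omega> c h (x i)" and "r \<notin> patch_squares \<Omega> c h (x i)"
    and "j < N" and "x j \<in> closure (interface \<Omega> c h q r)"
  shows "j \<in> base_stencil \<Omega> c h N x i"
proof -
  have "interface \<Omega> c h q r \<in> patch_interfaces \<Omega> c h (x i)"
    unfolding patch_interfaces_def interfaces_def patch_def
    using interface_subset_frontier[OF assms(1,2,4,5)] assms(3) by blast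
  then show ?thesis
    using assms(6,7) by (auto simp: base_stencil_def)
qed

lemma patch_squares_subset: "patch_squares \<Omega> c h p \<subseteq> {q. p \<in> grid_square c h q}"
proof -
  have "closure (subdomain \<Omega> c h q) \<subseteq> grid_square c h q" for q
    by (rule closure_minimal) (auto simp: subdomain_def closed_grid_square)
  then show ?thesis
    by (auto simp: patch_squares_def)
qed

lemma closure_interface_in_patch_squares:
  assumes "side_by_side \<Omega> c h q r" and "p \<in> closure (interface \<Omega> c h q r)"
  shows "q \<in> patch_squares \<Omega> c h p"
proof -
  have "interface \<Omega> c h q r \<subseteq> subdomain \<Omega> c h q"
    by (auto simp: interface_def subdomain_def)
  then have "p \<in> closure (subdomain \<Omega> c h q)"
    using assms(2) closure_mono by blast
  then show ?thesis
    using side_by_side_in_tessellation[OF assms(1)] by (simp add: patch_squares_def)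
qed

text \<open>
  A patch has at most four squares, so larger tessellations are cut by it.
\<close>

lemma patch_has_outgoing_interface:
  assumes "h > 0" and "connected \<Omega>" and card: "card (tessellation \<Omega> c h) > 4"
    and "J \<in> interfaces \<Omega> c h" and "p \<in> closure J"
  obtains q r where "q \<in> patch_squares \<Omega> c h p" "r \<notin> patch_squares \<Omega> c h p"
    "side_by_side \<Omega> c h q r"
proof -
  let ?P = "patch_squares \<Omega> c h p"
  have "?P \<noteq> {}"
    using assms(4,5) closure_interface_in_patch_squares unfolding interfaces_def by blast
  moreover have "card ?P \<le> 4"
    using card_mono[OF finite_squares_containing_point[OF assms(1)] patch_squares_subset]
      card_squares_containing_point[OF assms(1)] le_trans by blast
  then have "?P \<noteq> tessellation \<Omega> c h"
    using card by auto
  moreover have "?P \<subseteq> tessellation \<Omega> c h"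
    by (auto simp: patch_squares_def)
  moreover have "finite (tessellation \<Omega> c h)"
    using card by (intro card_ge_0_finite) simp
  ultimately show thesis
    using neighbours_across_cut[OF assms(1,2)] that by blast
qed

text \<open>
  The two squares of the interface are in the patch, and a point that is not a grid
  node is in no third square.
\<close>

lemma mid_knot:
  assumes "h > 0" and "open \<Omega>" and "side_by_side \<Omega> c h q r"
    and p: "p \<in> closure (interface \<Omega> c h q r)" "p \<notin> end_points \<Omega> c h"
  shows mid_knot_in_domain: "p \<in> \<Omega>"
    and mid_knot_patch_squares: "patch_squares \<Omega> c h p = {q, r}"
proof -
  have "interface \<Omega> c h q r \<in> interfaces \<Omega> c h"
    using assms(3) unfolding interfaces_def by blast
  then have "p \<notin> frontier \<Omega>"
    using p by (auto simp: end_points_def)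
  moreover have "p \<in> closure \<Omega>"
    using p(1) closure_mono[of "interface \<Omega> c h q r" \<Omega>] by (auto simp: interface_def)
  ultimately show "p \<in> \<Omega>"
    using \<open>open \<Omega>\<close> by (simp add: frontier_def interior_open)
  then have "p \<notin> range (grid_node c h)"
    using p(2) by (auto simp: end_points_def)
  then have card: "card {s. p \<in> grid_square c h s} \<le> 2"
    using card_squares_containing_non_node assms(1) by blast
  have sub: "{q, r} \<subseteq> patch_squares \<Omega> c h p"
    using closure_interface_in_patch_squares assms(3) p(1)
      side_by_side_commute interface_commute by (metis empty_subsetI insert_subset)
  have "{q, r} = {s. p \<in> grid_square c h s}"
  proof (rule card_seteq[OF finite_squares_containing_point[OF assms(1)]])
    show "{q, r} \<subseteq> {s. p \<in> grid_square c h s}"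
      using sub patch_squares_subset by blast
    show "card {s. p \<in> grid_square c h s} \<le> card {q, r}"
      using card side_by_side_distinct[OF assms(3)] by simp
  qed
  then show "patch_squares \<Omega> c h p = {q, r}"
    using sub patch_squares_subset by blast
qed


section \<open>Knots reachable through stencils\<close>

text \<open>
  The geometric half of strong connectivity. A knot in \<open>R\<close> brings in all the knots in \<open>I\<close> of some
  interface leading out of its patch. An interface with this property (\<open>full\<close> below) has a mid
  knot in \<open>R\<close>, whose patch borders the other interfaces of the same two squares, so
  fullness spreads along the neighbour graph.
\<close>

lemma knots_closed_under_stencils:
  assumes "h > 0" and "open \<Omega>" and "connected \<Omega>"
    and card: "card (tessellation \<Omega> c h) > 4"
    and knots: "knot_family \<Omega> c h N x"
    and I: "I \<subseteq> {0..<N}" and interior_knots: "\<And>i. i < N \<Longrightarrow> x i \<in> \<Omega> \<Longrightarrow> i \<in> I"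
    and R: "R \<subseteq> I" "R \<noteq> {}"
    and closed: "\<And>i j. i \<in> R \<Longrightarrow> j \<in> I \<Longrightarrow> j \<in> base_stencil \<Omega> c h N x i \<Longrightarrow> j \<in> R"
  shows "R = I"
proof -
  define full where "full q r \<longleftrightarrow> side_by_side \<Omega> c h q r \<and>
      (\<forall>j\<in>I. x j \<in> closure (interface \<Omega> c h q r) \<longrightarrow> j \<in> R)" for q r
  have knot_on_interface: "\<exists>J\<in>interfaces \<Omega> c h. x i \<in> closure J" if "i \<in> I" for i
    using knots I that unfolding knot_family_def by blast
  have full_commute: "full r q" if "full q r" for q r
    using that side_by_side_commute interface_commute unfolding full_def by metis
  have full_outgoing: "full q r"
    if "i \<in> R" "side_by_side \<Omega> c h q r"
      "q \<in> patch_squares \<Omega> c h (x i)" "r \<notin> patch_squares \<Omega> c h (x i)" for i q r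
    unfolding full_def
  proof (intro conjI ballI impI)
    fix j assume j: "j \<in> I" "x j \<in> closure (interface \<Omega> c h q r)"
    then have "j < N"
      using I by auto
    then show "j \<in> R"
      using closed[OF that(1) j(1)] j(2)
        base_stencil_across_patch_boundary[where x = x and i = i, OF assms(1,2) that(2-4)]
      by blast
  qed (fact that(2))
  have full_spread: "full q s" if qr: "full q r" and qs: "side_by_side \<Omega> c h q s" for q r s
  proof (cases "s = r")
    case True
    then show ?thesis
      using qr by simp
  next
    case False
    have side: "side_by_side \<Omega> c h q r"
      using qr by (simp add: full_def)
    then obtain i where i: "i < N" "x i \<in> closure (interface \<Omega> c h q r)" "x i \<notin> end_points \<Omega> c h"
      using knots unfolding knot_family_def interfaces_def by blast
    note mid = mid_knot[OF assms(1,2) side i(2,3)]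
    have "i \<in> R"
      using qr i interior_knots[OF i(1) mid(1)] by (simp add: full_def)
    then show ?thesis
      using full_outgoing[OF _ qs] mid(2) False side_by_side_distinct[OF qs] by auto
  qed
  obtain i where "i \<in> R"
    using R(2) by auto
  then obtain J where "J \<in> interfaces \<Omega> c h" "x i \<in> closure J"
    using knot_on_interface R(1) by blast
  then obtain q r where "q \<in> patch_squares \<Omega> c h (x i)" "r \<notin> patch_squares \<Omega> c h (x i)"
    "side_by_side \<Omega> c h q r"
    using patch_has_outgoing_interface[OF assms(1,3) card] by blast
  then have "full q r"
    using full_outgoing \<open>i \<in> R\<close> by blast
  define B where "B = {q. \<exists>r. full q r}"
  have "B = tessellation \<Omega> c h"
  proof (rule ccontr)
    assume proper: "B \<noteq> tessellation \<Omega> c h"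
    have sub: "B \<subseteq> tessellation \<Omega> c h"
      unfolding B_def full_def using side_by_side_in_tessellation by blast
    have nonempty: "B \<noteq> {}"
      using \<open>full q r\<close> unfolding B_def by blast
    have fin: "finite (tessellation \<Omega> c h)"
      using card by (intro card_ge_0_finite) simp
    obtain s t where "s \<in> B" "t \<in> tessellation \<Omega> c h - B" "side_by_side \<Omega> c h s t"
      using neighbours_across_cut[OF assms(1,3) fin sub nonempty proper] .
    then show False
      unfolding B_def using full_spread full_commute by blast
  qed
  then have "full s t" if "side_by_side \<Omega> c h s t" for s t
    using that full_spread side_by_side_in_tessellation[OF that] unfolding B_def by blast
  then have "I \<subseteq> R"
    using knot_on_interface unfolding full_def interfaces_def by blast
  then show ?thesis
    using R(1) by blast
qed

theorem theorem4:
  fixes \<Omega> \<Gamma>\<^sub>A \<Gamma>\<^sub>R :: "(real \<times> real) set"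
    and c :: "real \<times> real" and h :: real and M N :: nat
    and x :: "nat \<Rightarrow> real \<times> real"
    and S :: "nat \<Rightarrow> nat set"
    and G :: "real mat"
  assumes "bounded \<Omega>" and "open \<Omega>" and "connected \<Omega>"
    and "frontier \<Omega> = \<Gamma>\<^sub>A \<union> \<Gamma>\<^sub>R" and "\<Gamma>\<^sub>A \<inter> \<Gamma>\<^sub>R = {}" and "\<Gamma>\<^sub>A \<noteq> {}"
    and "valid_tessellation \<Omega> c h M"
    and "knot_family \<Omega> c h N x"
    and "\<And>i. i < N \<Longrightarrow> x i \<notin> \<Gamma>\<^sub>A \<Longrightarrow> admissible_stencil \<Omega> c h N x i (S i)"
    and "pddsparse_pattern N x \<Gamma>\<^sub>A S G"
  defines "Gstar \<equiv> submatrix G (non_absorbing N x \<Gamma>\<^sub>A) (non_absorbing N x \<Gamma>\<^sub>A)"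
  shows "irreducible_mat Gstar \<and> strongly_connected (mat_digraph Gstar)"
proof -
  let ?I = "non_absorbing N x \<Gamma>\<^sub>A"
  have h: "h > 0" and card: "card (tessellation \<Omega> c h) \<ge> 9"
    and neighbour: "\<forall>q\<in>tessellation \<Omega> c h. \<exists>r\<in>tessellation \<Omega> c h. side_by_side \<Omega> c h q r"
    using assms(7) unfolding valid_tessellation_def by simp_all
  have G: "G \<in> carrier_mat N N"
    and pattern: "\<And>i j. i \<in> ?I \<Longrightarrow> j < N \<Longrightarrow> j \<noteq> i \<Longrightarrow> G $$ (i, j) \<noteq> 0 \<longleftrightarrow> j \<in> S i"
    using assms(10) unfolding pddsparse_pattern_def non_absorbing_def by auto
  have I: "?I \<subseteq> {0..<N}"
    by (auto simp: non_absorbing_def)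
  have interior_knots: "i \<in> ?I" if "i < N" "x i \<in> \<Omega>" for i
    using that assms(2,4) by (auto simp: non_absorbing_def frontier_def interior_open)
  have "tessellation \<Omega> c h \<noteq> {}"
    using card by auto
  then obtain q r where side: "side_by_side \<Omega> c h q r"
    using neighbour by blast
  then obtain i where i: "i < N" "x i \<in> closure (interface \<Omega> c h q r)" "x i \<notin> end_points \<Omega> c h"
    using assms(8) unfolding knot_family_def interfaces_def by blast
  then have "?I \<noteq> {}"
    using interior_knots mid_knot_in_domain[OF h assms(2) side] by blast
  have "strongly_connected (mat_digraph Gstar)"
    unfolding Gstar_def
  proof (rule strongly_connected_submatrixI[OF G I \<open>?I \<noteq> {}\<close>])
    fix R
    assume R: "R \<subseteq> ?I" "R \<noteq> {}"
      and closed: "\<And>i j. i \<in> R \<Longrightarrow> j \<in> ?I \<Longrightarrow> G $$ (i, j) \<noteq> 0 \<Longrightarrow> j \<in> R"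
    have "j \<in> R" if "i \<in> R" "j \<in> ?I" "j \<in> base_stencil \<Omega> c h N x i" for i j
    proof (cases "j = i")
      case False
      have "i \<in> ?I"
        using that(1) R(1) by blast
      then have "j \<in> S i"
        using that(3) assms(9)[of i] by (auto simp: admissible_stencil_def non_absorbing_def)
      then show ?thesis
        using closed[OF that(1,2)] pattern[OF \<open>i \<in> ?I\<close>] False that(2) I by auto
    qed (use that(1) in simp)
    then show "R = ?I"
      using knots_closed_under_stencils[OF h assms(2,3) _ assms(8) I interior_knots R] card by auto
  qed
  moreover have "square_mat Gstar"
    using G by (simp add: Gstar_def dim_submatrix)
  ultimately show ?thesis
    using irreducible_mat_if_strongly_connected by blast
qed

end
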